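(* Consider the fidelity estimation problem with a single observable $O=|\psi\rangle\langle\psi|$ for a pure state $|\psi\rangle\in\mathbb{C}^d$, and unknown state $\rho=\mathbb{I}_d/d$. Let $K$ be the batch size of the median-of-means classical shadows estimator. For $n$ sufficiently large, $\gamma\ge 1/K$, and $d\ge 1000$, there exists an adversary that corrupts an $O(\gamma)$ fraction of the outcome vectors $|v_1\rangle,\ldots,|v_n\rangle$ and causes an error of at least $\Omega(\gamma d)$ for the median-of-means estimator.
   Context: Uniform POVM / classical shadows: each of $n$ copies of $\rho\in\mathbb{C}^{d\times d}$ is measured with the uniform POVM $\{d|v\rangle\langle v|\,\mathrm{d}v\}$ over unit vectors $|v\rangle\in\mathbb{C}^d$ ($\mathrm{d}v$ the unitarily invariant (Haar) probability measure on the complex unit sphere), so the outcome $|v\rangle$ has density $d\langle v|\rho|v\rangle$ with respect to $\mathrm{d}v$; this gives outcomes $|v_1\rangle,\ldots,|v_n\rangle$. Since $\operatorname{Tr}[O\rho]=(d+1)\mathbb{E}[\langle v|O|v\rangle]-\operatorname{Tr}[O]$, the median-of-means estimator with batch size $K$ divides the $n$ outcomes into $n/K$ batches of $K$ outcomes each, computes in each batch the empirical mean of $(d+1)\langle v_j|O|v_j\rangle-\operatorname{Tr}[O]$, and outputs the median of these batch means. The adversary may replace outcome vectors $|v_j\rangle$ by arbitrary unit vectors.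
   Formalization: The formal statement also assumes γ ≤ 1: the estimator always lies in [-1, d], so an error of Ω(γd) is impossible for large γ; n runs over multiples of K, and "n sufficiently large" is read as success with probability tending to 1. *)

theory Defs
  imports "HOL-Probability.Probability"
begin

text \<open>Vectors in C^d are represented as extensional functions nat => complex
  supported on {..<d}; d x d matrices as nat => nat => complex (entries i,j < d).\<close>

type_synonym cvec = "nat \<Rightarrow> complex"
type_synonym cmat = "nat \<Rightarrow> nat \<Rightarrow> complex"

definition sqnorm :: "nat \<Rightarrow> cvec \<Rightarrow> real" where
  "sqnorm d v = (\<Sum>i<d. (cmod (v i))\<^sup>2)"

definition lebesgue_cvec :: "nat \<Rightarrow> cvec measure" where
  "lebesgue_cvec d = PiM {..<d} (\<lambda>_. (lborel :: complex measure))"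

definition borel_cvec :: "nat \<Rightarrow> cvec measure" where
  "borel_cvec d = PiM {..<d} (\<lambda>_. (borel :: complex measure))"

definition unit_ball_c :: "nat \<Rightarrow> cvec set" where
  "unit_ball_c d = {v \<in> {..<d} \<rightarrow>\<^sub>E UNIV. sqnorm d v \<le> 1}"

definition unit_sphere_c :: "nat \<Rightarrow> cvec set" where
  "unit_sphere_c d = {v \<in> {..<d} \<rightarrow>\<^sub>E UNIV. sqnorm d v = 1}"

definition normalize_c :: "nat \<Rightarrow> cvec \<Rightarrow> cvec" where
  "normalize_c d v = restrict (\<lambda>i. v i / complex_of_real (sqrt (sqnorm d v))) {..<d}"

text \<open>The unitarily invariant (Haar) probability measure on the complex unit sphere
  of C^d, realised as the radial projection of the uniform distribution on the
  unit ball (the normalised cone / surface measure).\<close>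
definition uniform_sphere :: "nat \<Rightarrow> cvec measure" where
  "uniform_sphere d =
     distr (uniform_measure (lebesgue_cvec d) (unit_ball_c d))
           (restrict_space (borel_cvec d) (unit_sphere_c d)) (normalize_c d)"

definition qform :: "nat \<Rightarrow> cmat \<Rightarrow> cvec \<Rightarrow> complex" where
  "qform d A v = (\<Sum>i<d. \<Sum>j<d. cnj (v i) * A i j * v j)"

definition mtrace :: "nat \<Rightarrow> cmat \<Rightarrow> complex" where
  "mtrace d A = (\<Sum>i<d. A i i)"

definition mmult :: "nat \<Rightarrow> cmat \<Rightarrow> cmat \<Rightarrow> cmat" where
  "mmult d A B = (\<lambda>i j. \<Sum>k<d. A i k * B k j)"

definition povm_outcome :: "nat \<Rightarrow> cmat \<Rightarrow> cvec measure" where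
  "povm_outcome d \<rho> = density (uniform_sphere d) (\<lambda>v. ennreal (real d * Re (qform d \<rho> v)))"

definition povm_samples :: "nat \<Rightarrow> cmat \<Rightarrow> nat \<Rightarrow> (nat \<Rightarrow> cvec) measure" where
  "povm_samples d \<rho> n = PiM {..<n} (\<lambda>_. povm_outcome d \<rho>)"

definition maximally_mixed :: "nat \<Rightarrow> cmat" where
  "maximally_mixed d = (\<lambda>i j. if i = j then 1 / of_nat d else 0)"

definition projector :: "cvec \<Rightarrow> cmat" where
  "projector \<psi> = (\<lambda>i j. \<psi> i * cnj (\<psi> j))"

text \<open>Single-shot unbiased estimate (d+1)<v|O|v> - Tr O.\<close>
definition shadow_est :: "nat \<Rightarrow> cmat \<Rightarrow> cvec \<Rightarrow> real" where
  "shadow_est d Obs v = real (d + 1) * Re (qform d Obs v) - Re (mtrace d Obs)"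

definition median :: "real list \<Rightarrow> real" where
  "median xs = (let ys = sort xs; m = length xs in
     if odd m then ys ! (m div 2) else (ys ! (m div 2 - 1) + ys ! (m div 2)) / 2)"

definition batch_mean :: "nat \<Rightarrow> cmat \<Rightarrow> nat \<Rightarrow> (nat \<Rightarrow> cvec) \<Rightarrow> nat \<Rightarrow> real" where
  "batch_mean d Obs K v b = (\<Sum>j\<in>{b*K..<b*K+K}. shadow_est d Obs (v j)) / real K"

definition mom_estimate :: "nat \<Rightarrow> cmat \<Rightarrow> nat \<Rightarrow> nat \<Rightarrow> (nat \<Rightarrow> cvec) \<Rightarrow> real" where
  "mom_estimate d Obs K n v = median (map (batch_mean d Obs K v) [0..<n div K])"

end

theory Submission
  imports Defs
begin

text \<open>
  The adversary may look at the outcomes. If the median of means is already off by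
  \<open>\<gamma> d / 4\<close> it does nothing. Otherwise, in every batch it replaces the
  \<open>m = \<lceil>\<gamma> K\<rceil>\<close> outcomes with the smallest single-shot estimates by \<open>\<psi>\<close>, whose
  single-shot estimate is \<open>d\<close>. The removed values average at most the old batch mean \<open>M\<close>,
  so the new batch mean is at least \<open>(1 - m / K) M + (m / K) d\<close>. This is an increasing affine
  function of \<open>M\<close>, so the same bound holds for the medians, and it moves the median from near
  \<open>1 / d\<close> to at least \<open>1 / d + \<gamma> d / 4\<close>. This works for every sample, so that no
  concentration argument is needed.
\<close>

section \<open>Order statistics and the median\<close>

text \<open>Counting replaces any reasoning about permutations: the entry of rank \<open>k\<close>
  in sorted order is at most \<open>t\<close> exactly when more than \<open>k\<close> entries are at
  most \<open>t\<close>. Raising entries pointwise can only shrink the set of positions with value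
  at most \<open>t\<close>.\<close>

lemma sort_nth_mono:
  fixes xs ys :: "'a :: linorder list"
  assumes len: "length xs = length ys" and le: "\<And>i. i < length xs \<Longrightarrow> xs ! i \<le> ys ! i"
    and k: "k < length xs"
  shows "sort xs ! k \<le> sort ys ! k"
proof (rule ccontr)
  assume "\<not> sort xs ! k \<le> sort ys ! k"
  then have gt: "sort ys ! k < sort xs ! k" by simp
  define t where "t = sort ys ! k"
  have count: "length (filter (\<lambda>x. x \<le> t) zs) = card {i. i < length zs \<and> sort zs ! i \<le> t}" for zs
  proof -
    have "length (filter (\<lambda>x. x \<le> t) zs) = length (filter (\<lambda>x. x \<le> t) (sort zs))"
      by (metis mset_filter mset_sort size_mset)
    then show ?thesis by (simp add: length_filter_conv_card)
  qed
  have "{..k} \<subseteq> {i. i < length ys \<and> sort ys ! i \<le> t}"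
    using k len by (auto simp: t_def intro!: sorted_nth_mono)
  then have "card {..k} \<le> card {i. i < length ys \<and> sort ys ! i \<le> t}"
    by (intro card_mono) auto
  then have ys: "k < length (filter (\<lambda>x. x \<le> t) ys)"
    unfolding count by simp
  have "{i. i < length xs \<and> sort xs ! i \<le> t} \<subseteq> {..<k}"
  proof clarify
    fix i assume i: "i < length xs" "sort xs ! i \<le> t"
    show "i < k"
    proof (rule ccontr)
      assume "\<not> i < k"
      then have "sort xs ! k \<le> sort xs ! i"
        using i by (intro sorted_nth_mono) auto
      then show False using i gt by (simp add: t_def)
    qed
  qed
  then have "card {i. i < length xs \<and> sort xs ! i \<le> t} \<le> card {..<k}"
    by (intro card_mono) auto
  then have xs: "length (filter (\<lambda>x. x \<le> t) xs) \<le> k"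
    unfolding count by simp
  have "{i. i < length ys \<and> ys ! i \<le> t} \<subseteq> {i. i < length xs \<and> xs ! i \<le> t}"
    using le len by (auto intro: order_trans)
  then have "length (filter (\<lambda>x. x \<le> t) ys) \<le> length (filter (\<lambda>x. x \<le> t) xs)"
    unfolding length_filter_conv_card by (intro card_mono) auto
  then show False using xs ys by simp
qed

lemma median_mono:
  assumes "length xs = length ys" and "\<And>i. i < length xs \<Longrightarrow> xs ! i \<le> ys ! i" and "xs \<noteq> []"
  shows "median xs \<le> median ys"
proof -
  have le: "sort xs ! k \<le> sort ys ! k" if "k < length xs" for k
    using sort_nth_mono[OF assms(1,2) that] .
  have "length xs div 2 < length xs" "length xs div 2 - 1 < length xs"
    using assms(3) by (cases xs; simp)+
  from le[OF this(1)] le[OF this(2)] show ?thesis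
    unfolding median_def Let_def using assms(1) by (auto intro!: divide_right_mono add_mono)
qed

text \<open>A map with nonnegative slope keeps a list sorted, so it commutes with
  \<open>sort\<close>; for even length it also commutes with averaging the two middle
  entries.\<close>

lemma median_affine:
  assumes "xs \<noteq> []" and "a \<ge> 0"
  shows "median (map (\<lambda>x. a * x + b) xs) = a * median xs + b"
proof -
  have "sorted (map (\<lambda>x. a * x + b) (sort xs))"
    unfolding sorted_map
    by (rule sorted_wrt_mono_rel[OF _ sorted_sort[unfolded sorted_wrt_true]])
       (use assms(2) in \<open>auto intro: mult_left_mono\<close>)
  then have srt: "sort (map (\<lambda>x. a * x + b) xs) = map (\<lambda>x. a * x + b) (sort xs)"
    by (intro properties_for_sort) auto
  have "length xs div 2 < length xs" "length xs div 2 - 1 < length xs"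
    using assms(1) by (cases xs; simp)+
  then show ?thesis
    unfolding median_def Let_def srt by (simp add: field_simps)
qed

text \<open>Discarding a largest element again and again leaves a subset whose average is at most
  that of \<open>A\<close>. Multiplying out the averages avoids division by zero for
  \<open>m = 0\<close> or empty \<open>A\<close>.\<close>

lemma ex_subset_sum_le_average:
  fixes f :: "'a \<Rightarrow> real"
  assumes "finite A" and "m \<le> card A"
  shows "\<exists>S\<subseteq>A. card S = m \<and> real (card A) * sum f S \<le> real m * sum f A"
  using assms
proof (induction "card A" arbitrary: A)
  case 0
  then show ?case by (intro exI[of _ "{}"]) auto
next
  case (Suc n)
  show ?case
  proof (cases "m = Suc n")
    case True
    then show ?thesis using Suc by (intro exI[of _ A]) auto
  next
    case False
    have "A \<noteq> {}" using Suc by auto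
    then have "Max (f ` A) \<in> f ` A" using Suc(3) by (intro Max_in) auto
    then obtain x where x: "x \<in> A" "Max (f ` A) = f x" by auto
    have x_max: "f y \<le> f x" if "y \<in> A" for y
      using Suc(3) that unfolding x(2)[symmetric] by (intro Max_ge) auto
    have card: "card (A - {x}) = n" using Suc(2,3) x by simp
    obtain S where S: "S \<subseteq> A - {x}" "card S = m"
      "real n * sum f S \<le> real m * sum f (A - {x})"
      using Suc(1)[of "A - {x}"] Suc(2-4) card False by auto
    have sumA: "sum f A = f x + sum f (A - {x})"
      using Suc(3) x by (simp add: sum.remove)
    have "sum f S \<le> real (card S) * f x"
      using S(1) x_max by (intro sum_bounded_above) auto
    \<comment> \<open>Adds the bound \<open>sum f S\<close> \<le> \<open>m * f x\<close> to the
      induction hypothesis; \<open>x\<close> is the discarded maximum.\<close>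
    then have "real (Suc n) * sum f S \<le> real m * sum f A"
      using S(2,3) unfolding sumA by (simp add: algebra_simps)
    then show ?thesis using S Suc(2) by auto
  qed
qed

section \<open>The outcome distribution\<close>

lemma sqnorm_measurable [measurable]:
  "sqnorm d \<in> borel_measurable (borel_cvec d)"
  unfolding sqnorm_def borel_cvec_def by measurable

lemma space_borel_cvec: "space (borel_cvec d) = {..<d} \<rightarrow>\<^sub>E UNIV"
  by (simp add: borel_cvec_def space_PiM)

lemma sets_lebesgue_cvec: "sets (lebesgue_cvec d) = sets (borel_cvec d)"
  unfolding lebesgue_cvec_def borel_cvec_def by (intro sets_PiM_cong) auto

lemma unit_ball_c_sets: "unit_ball_c d \<in> sets (borel_cvec d)"
proof -
  have "unit_ball_c d = {v \<in> space (borel_cvec d). sqnorm d v \<le> 1}"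
    by (simp add: unit_ball_c_def space_borel_cvec)
  then show ?thesis by simp
qed

lemma unit_sphere_c_sets: "unit_sphere_c d \<in> sets (borel_cvec d)"
proof -
  have "unit_sphere_c d = {v \<in> space (borel_cvec d). sqnorm d v = 1}"
    by (simp add: unit_sphere_c_def space_borel_cvec)
  then show ?thesis by simp
qed

lemma normalize_c_measurable: "normalize_c d \<in> borel_cvec d \<rightarrow>\<^sub>M borel_cvec d"
proof -
  have "(\<lambda>v. \<lambda>i\<in>{..<d}. v i / complex_of_real (sqrt (sqnorm d v))) \<in> borel_cvec d \<rightarrow>\<^sub>M
     PiM {..<d} (\<lambda>_. borel)"
  proof (rule measurable_restrict)
    fix i assume i: "i \<in> {..<d}"
    have [measurable]: "(\<lambda>v. v i) \<in> borel_measurable (borel_cvec d)"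
      unfolding borel_cvec_def using i by measurable
    show "(\<lambda>v. v i / complex_of_real (sqrt (sqnorm d v))) \<in> borel_measurable (borel_cvec d)"
      by measurable
  qed
  then show ?thesis unfolding normalize_c_def[abs_def] borel_cvec_def .
qed

lemma normalize_c_in_sphere:
  assumes "sqnorm d v \<noteq> 0"
  shows "normalize_c d v \<in> unit_sphere_c d"
proof -
  have pos: "sqnorm d v > 0"
    using assms by (metis sqnorm_def less_eq_real_def sum_nonneg zero_le_power2)
  have "sqnorm d (normalize_c d v) = (\<Sum>i<d. (cmod (v i))\<^sup>2 / sqnorm d v)"
    using pos unfolding sqnorm_def[of d "normalize_c d v"]
    by (intro sum.cong) (auto simp: normalize_c_def norm_divide power_divide)
  also have "\<dots> = 1"
    using pos by (simp add: sum_divide_distrib[symmetric] sqnorm_def)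
  finally show ?thesis by (simp add: unit_sphere_c_def normalize_c_def)
qed

section \<open>Volume of the unit ball and the null set at the origin\<close>

interpretation lborel_complex: product_sigma_finite "\<lambda>_ :: nat. lborel :: complex measure"
  by unfold_locales

lemma emeasure_lebesgue_cvec_PiE:
  assumes "A \<in> sets borel"
  shows "emeasure (lebesgue_cvec d) ({..<d} \<rightarrow>\<^sub>E A) = emeasure lborel A ^ d"
  unfolding lebesgue_cvec_def using assms by (subst lborel_complex.emeasure_PiM) auto

text \<open>The ball lies in a product of \<open>d\<close> unit discs, whose volume is a finite
  power.\<close>

lemma emeasure_unit_ball_c_finite: "emeasure (lebesgue_cvec d) (unit_ball_c d) < \<infinity>"
proof -
  have "unit_ball_c d \<subseteq> ({..<d} \<rightarrow>\<^sub>E cball 0 1)"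
  proof
    fix v assume v: "v \<in> unit_ball_c d"
    have "cmod (v i) \<le> 1" if "i < d" for i
    proof -
      have "(cmod (v i))\<^sup>2 \<le> sqnorm d v"
        unfolding sqnorm_def using that by (intro member_le_sum) auto
      then have "(cmod (v i))\<^sup>2 \<le> 1\<^sup>2" using v by (simp add: unit_ball_c_def)
      then show ?thesis by (rule power2_le_imp_le) simp
    qed
    then show "v \<in> ({..<d} \<rightarrow>\<^sub>E cball 0 1)"
      using v by (auto simp: unit_ball_c_def PiE_iff)
  qed
  then have "emeasure (lebesgue_cvec d) (unit_ball_c d) \<le>
      emeasure (lebesgue_cvec d) ({..<d} \<rightarrow>\<^sub>E cball 0 1)"
    by (intro emeasure_mono) (auto simp: lebesgue_cvec_def intro!: sets_PiM_I_finite)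
  also have "\<dots> < \<infinity>"
    using emeasure_lborel_cball_finite[of "0::complex" 1]
    by (simp add: emeasure_lebesgue_cvec_PiE power_less_top_ennreal)
  finally show ?thesis .
qed

lemma emeasure_unit_ball_c_pos: "emeasure (lebesgue_cvec d) (unit_ball_c d) > 0"
proof -
  \<comment> \<open>A product of discs of radius \<open>r\<close> fits inside the ball because
    \<open>d * r^2 = d / (d + 1)\<close> is at most 1; the \<open>+ 1\<close> keeps \<open>r\<close>
    positive when \<open>d = 0\<close>.\<close>
  define r where "r = 1 / sqrt (real d + 1)"
  have r: "r > 0" "r\<^sup>2 = 1 / (real d + 1)"
    by (auto simp: r_def power_divide)
  have "({..<d} \<rightarrow>\<^sub>E cball 0 r) \<subseteq> unit_ball_c d"
  proof
    fix v assume v: "v \<in> ({..<d} \<rightarrow>\<^sub>E cball (0::complex) r)"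
    have "sqnorm d v \<le> (\<Sum>i<d. r\<^sup>2)"
      unfolding sqnorm_def using v by (intro sum_mono power_mono) (auto simp: PiE_iff)
    also have "\<dots> \<le> 1" by (simp add: r(2))
    finally show "v \<in> unit_ball_c d" using v by (auto simp: unit_ball_c_def PiE_iff)
  qed
  then have "emeasure (lebesgue_cvec d) ({..<d} \<rightarrow>\<^sub>E cball 0 r) \<le>
      emeasure (lebesgue_cvec d) (unit_ball_c d)"
    by (intro emeasure_mono) (simp_all add: sets_lebesgue_cvec unit_ball_c_sets)
  moreover have "emeasure lborel (cball (0::complex) r) > 0"
    using content_cball_pos[OF r(1), of "0::complex"]
    unfolding zero_less_iff_neq_zero by (auto simp: measure_def)
  then have "emeasure lborel (cball (0::complex) r) ^ d > 0"
    unfolding zero_less_iff_neq_zero by (rule power_not_zero)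
  ultimately show ?thesis
    by (simp add: emeasure_lebesgue_cvec_PiE)
qed

text \<open>The set is a product of \<open>d\<close> copies of the null set \<open>{0}\<close>. For
  \<open>d = 0\<close> that product would have measure 1, hence the hypothesis.\<close>

lemma sqnorm_eq_0_null:
  assumes "d > 0"
  shows "{v \<in> space (lebesgue_cvec d). sqnorm d v = 0} \<in> null_sets (lebesgue_cvec d)"
proof -
  have "{v \<in> space (lebesgue_cvec d). sqnorm d v = 0} = ({..<d} \<rightarrow>\<^sub>E {0})"
    by (auto simp: lebesgue_cvec_def space_PiM sqnorm_def sum_nonneg_eq_0_iff PiE_iff
        extensional_def)
  moreover have "emeasure (lebesgue_cvec d) ({..<d} \<rightarrow>\<^sub>E {0}) = 0"
    using assms by (subst emeasure_lebesgue_cvec_PiE) auto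
  moreover have "({..<d} \<rightarrow>\<^sub>E {0}) \<in> sets (lebesgue_cvec d)"
    unfolding lebesgue_cvec_def by (intro sets_PiM_I_finite) auto
  ultimately show ?thesis by (simp add: null_sets_def)
qed

text \<open>
  Because of \<open>x / 0 = 0\<close>, \<open>normalize_c d\<close> maps the origin to itself, outside the sphere, so it is
  not measurable into the restricted space and the usual rules for \<open>distr\<close> do not apply to
  \<open>uniform_sphere\<close>.
\<close>
lemma uniform_sphere_eq_restrict_space:
  "uniform_sphere d = restrict_space
     (distr (uniform_measure (lebesgue_cvec d) (unit_ball_c d)) (borel_cvec d) (normalize_c d))
     (unit_sphere_c d)"
proof -
  let ?M = "uniform_measure (lebesgue_cvec d) (unit_ball_c d)"
  let ?S = "unit_sphere_c d"
  have f: "normalize_c d \<in> ?M \<rightarrow>\<^sub>M borel_cvec d"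
    using normalize_c_measurable
    by (simp add: sets_lebesgue_cvec cong: measurable_cong_sets)
  have sub: "?S \<subseteq> space (borel_cvec d)"
    using unit_sphere_c_sets by (rule sets.sets_into_space)
  have S: "sets (restrict_space (borel_cvec d) ?S) = ((\<inter>) ?S) ` sets (borel_cvec d)"
    by (simp add: sets_restrict_space)
  have sp: "space (restrict_space (borel_cvec d) ?S) = ?S"
    using sub by (auto simp: space_restrict_space)
  have sig: "sigma_sets ?S (((\<inter>) ?S) ` sets (borel_cvec d)) = ((\<inter>) ?S) ` sets (borel_cvec d)"
    using sets.sigma_sets_eq[of "restrict_space (borel_cvec d) ?S"] unfolding S sp .
  show ?thesis
    \<comment> \<open>Both sides become \<open>measure_of\<close> over the same sets. The two set
      functions need to agree only on measurable subsets of the sphere, where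
      \<open>emeasure_distr\<close> for the map into the whole space applies.\<close>
    unfolding uniform_sphere_def
    unfolding distr_def[of _ "restrict_space (borel_cvec d) ?S"] S sp restrict_space_def[of "distr _ _ _"]
    using sub unit_sphere_c_sets[of d]
    by (auto simp: Int_absorb2 sig emeasure_distr[OF f] intro!: measure_of_eq
        dest: sets.sets_into_space)
qed

lemma space_uniform_sphere: "space (uniform_sphere d) = unit_sphere_c d"
  using sets.sets_into_space[OF unit_sphere_c_sets[of d]]
  by (auto simp: uniform_sphere_def space_restrict_space)

text \<open>Only vectors of norm zero can miss the sphere under \<open>normalize_c\<close>, and they
  form a null set. The pushforward to the whole space thus gives the sphere mass 1, and restricting
  to it loses nothing.\<close>

lemma prob_space_uniform_sphere:
  assumes "d > 0"
  shows "prob_space (uniform_sphere d)"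
proof -
  let ?M = "uniform_measure (lebesgue_cvec d) (unit_ball_c d)"
  have f: "normalize_c d \<in> ?M \<rightarrow>\<^sub>M borel_cvec d"
    using normalize_c_measurable
    by (simp add: sets_lebesgue_cvec cong: measurable_cong_sets)
  interpret M: prob_space ?M
    using emeasure_unit_ball_c_finite[of d] emeasure_unit_ball_c_pos[of d]
    by (intro prob_space_uniform_measure) (auto simp: less_top)
  interpret D: prob_space "distr ?M (borel_cvec d) (normalize_c d)"
    by (rule M.prob_space_distr[OF f])
  have "AE v in lebesgue_cvec d. sqnorm d v \<noteq> 0"
    using sqnorm_eq_0_null[OF assms] by (rule AE_I') auto
  then have "AE v in ?M. sqnorm d v \<noteq> 0"
    by (intro AE_uniform_measureI) (auto simp: sets_lebesgue_cvec unit_ball_c_sets)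
  then have "AE v in ?M. normalize_c d v \<in> unit_sphere_c d"
    by eventually_elim (rule normalize_c_in_sphere)
  then have "AE v in distr ?M (borel_cvec d) (normalize_c d). v \<in> unit_sphere_c d"
    using unit_sphere_c_sets[of d] f by (subst AE_distr_iff) auto
  then have "emeasure (distr ?M (borel_cvec d) (normalize_c d)) (unit_sphere_c d) = 1"
    using unit_sphere_c_sets[of d] by (intro D.emeasure_eq_1_AE) auto
  then show ?thesis
    unfolding uniform_sphere_eq_restrict_space
    using unit_sphere_c_sets[of d] by (intro prob_space_restrict_space) auto
qed

section \<open>Measuring the maximally mixed state\<close>

lemma qform_maximally_mixed:
  "qform d (maximally_mixed d) v = complex_of_real (sqnorm d v / real d)"
proof -
  have "qform d (maximally_mixed d) v = (\<Sum>i<d. cnj (v i) * v i / of_nat d)"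
    unfolding qform_def maximally_mixed_def
    by (intro sum.cong refl) (simp add: if_distrib[of "\<lambda>x. _ * x"] if_distrib[of "\<lambda>x. x * _"]
        sum.delta' cong: if_cong)
  also have "\<dots> = complex_of_real (sqnorm d v / real d)"
    by (simp add: sqnorm_def sum_divide_distrib complex_norm_square[symmetric] mult.commute[of "cnj _"])
  finally show ?thesis .
qed

text \<open>The outcome density \<open>d * (sqnorm d v / d)\<close> is identically 1 on the
  sphere.\<close>

lemma povm_outcome_maximally_mixed:
  assumes "d > 0"
  shows "povm_outcome d (maximally_mixed d) = uniform_sphere d"
proof -
  have one: "ennreal (real d * Re (qform d (maximally_mixed d) v)) = 1"
    if "v \<in> space (uniform_sphere d)" for v
    using that assms by (simp add: space_uniform_sphere unit_sphere_c_def qform_maximally_mixed)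
  have "povm_outcome d (maximally_mixed d) = density (uniform_sphere d) (\<lambda>_. 1)"
    unfolding povm_outcome_def
  proof (rule density_cong)
    show "(\<lambda>v. ennreal (real d * Re (qform d (maximally_mixed d) v)))
        \<in> borel_measurable (uniform_sphere d)"
      by (subst measurable_cong[OF one]) simp_all
  qed (auto simp: one)
  then show ?thesis by (simp add: density_1)
qed

section \<open>Corrupting the batches\<close>

lemma unit_sphere_c_sum:
  assumes "\<psi> \<in> unit_sphere_c d"
  shows "(\<Sum>i<d. cnj (\<psi> i) * \<psi> i) = 1"
proof -
  have "(\<Sum>i<d. cnj (\<psi> i) * \<psi> i) = complex_of_real (sqnorm d \<psi>)"
    by (simp add: sqnorm_def complex_norm_square[symmetric] mult.commute[of "cnj _"])
  then show ?thesis using assms by (simp add: unit_sphere_c_def)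
qed

text \<open>Both the quadratic form at \<psi> and the trace equal 1, leaving
  \<open>(d + 1) - 1\<close>.\<close>

lemma shadow_est_projector_self:
  assumes "\<psi> \<in> unit_sphere_c d"
  shows "shadow_est d (projector \<psi>) \<psi> = real d"
proof -
  have "qform d (projector \<psi>) \<psi> = (\<Sum>i<d. cnj (\<psi> i) * \<psi> i) * (\<Sum>j<d. cnj (\<psi> j) * \<psi> j)"
    unfolding qform_def projector_def sum_product by (simp add: mult_ac)
  moreover have "mtrace d (projector \<psi>) = (\<Sum>i<d. cnj (\<psi> i) * \<psi> i)"
    unfolding mtrace_def projector_def by (simp add: mult.commute)
  ultimately show ?thesis
    by (simp add: shadow_est_def unit_sphere_c_sum[OF assms])
qed

lemma mtrace_projector_maximally_mixed:
  assumes "\<psi> \<in> unit_sphere_c d"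
  shows "mtrace d (mmult d (projector \<psi>) (maximally_mixed d)) = 1 / of_nat d"
proof -
  have "mtrace d (mmult d (projector \<psi>) (maximally_mixed d)) = (\<Sum>i<d. cnj (\<psi> i) * \<psi> i / of_nat d)"
    unfolding mtrace_def mmult_def projector_def maximally_mixed_def
    by (intro sum.cong refl) (simp add: if_distrib[of "\<lambda>x. _ * x"] mult.commute cong: if_cong)
  then show ?thesis
    by (simp add: sum_divide_distrib[symmetric] unit_sphere_c_sum[OF assms])
qed

text \<open>A statement about one fixed sample: the bound is proved batch by batch, and
  \<open>m\<close> \<le> \<open>K\<close> makes the slope \<open>1 - m / K\<close> nonnegative, so
  that \<open>median_affine\<close> and \<open>median_mono\<close> carry it to the medians.\<close>

lemma mom_corruption:
  assumes K: "K \<ge> 1" and m: "m \<le> K" and N: "N > 0" and \<psi>: "\<psi> \<in> unit_sphere_c d"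
    and v: "\<And>j. j < N * K \<Longrightarrow> v j \<in> unit_sphere_c d"
  shows "\<exists>w. (\<forall>j < N * K. w j \<in> unit_sphere_c d) \<and>
    card {j. j < N * K \<and> w j \<noteq> v j} \<le> N * m \<and>
    mom_estimate d (projector \<psi>) K (N * K) w
      \<ge> (1 - real m / real K) * mom_estimate d (projector \<psi>) K (N * K) v + real m / real K * real d"
proof -
  define X where "X = (\<lambda>j. shadow_est d (projector \<psi>) (v j))"
  define B where "B = (\<lambda>b. {b*K..<b*K+K})"
  \<comment> \<open>Below-average choice of \<open>m\<close> positions in each batch; this
    inequality is all that the batch bound uses about the removed values.\<close>
  have "\<exists>S\<subseteq>B b. card S = m \<and> real K * sum X S \<le> real m * sum X (B b)" for b
    using ex_subset_sum_le_average[of "B b" m X] m by (simp add: B_def)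
  then obtain S where S: "\<And>b. S b \<subseteq> B b" "\<And>b. card (S b) = m"
      "\<And>b. real K * sum X (S b) \<le> real m * sum X (B b)"
    by metis
  have finS: "finite (S b)" for b
    using S(1)[of b] by (rule finite_subset) (simp add: B_def)
  \<comment> \<open>\<open>j div K\<close> is the batch containing \<open>j\<close>, so one formula
    corrupts all batches at once.\<close>
  define w where "w = (\<lambda>j. if j \<in> S (j div K) then \<psi> else v j)"
  have Bdiv: "j div K = b" if "j \<in> B b" for j b
    using that by (intro div_nat_eqI) (auto simp: B_def mult.commute)
  \<comment> \<open>Only an inclusion, since a selected outcome may already equal \<psi>.\<close>
  have "{j. j < N * K \<and> w j \<noteq> v j} \<subseteq> (\<Union>b<N. S b)"
  proof clarify
    fix j assume j: "j < N * K" "w j \<noteq> v j"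
    then have "j \<in> S (j div K)" by (auto simp: w_def split: if_splits)
    moreover have "j div K < N" using j(1) by (simp add: less_mult_imp_div_less)
    ultimately show "j \<in> (\<Union>b<N. S b)" by blast
  qed
  then have "card {j. j < N * K \<and> w j \<noteq> v j} \<le> card (\<Union>b<N. S b)"
    using finS by (intro card_mono) auto
  also have "\<dots> \<le> (\<Sum>b<N. card (S b))" by (rule card_UN_le) simp
  finally have card: "card {j. j < N * K \<and> w j \<noteq> v j} \<le> N * m" by (simp add: S(2))

  have batch: "(1 - real m / real K) * batch_mean d (projector \<psi>) K v b + real m / real K * real d
      \<le> batch_mean d (projector \<psi>) K w b" for b
  proof -
    have "(\<Sum>j\<in>B b. shadow_est d (projector \<psi>) (w j))
        = (\<Sum>j\<in>B b - S b. shadow_est d (projector \<psi>) (w j)) + (\<Sum>j\<in>S b. shadow_est d (projector \<psi>) (w j))"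
      using S(1) by (intro sum.subset_diff) (auto simp: B_def)
    also have "(\<Sum>j\<in>S b. shadow_est d (projector \<psi>) (w j)) = (\<Sum>j\<in>S b. real d)"
    proof (rule sum.cong)
      fix j assume "j \<in> S b"
      then have "w j = \<psi>" using Bdiv S(1) by (auto simp: w_def)
      then show "shadow_est d (projector \<psi>) (w j) = real d"
        using shadow_est_projector_self[OF \<psi>] by simp
    qed simp
    also have "(\<Sum>j\<in>B b - S b. shadow_est d (projector \<psi>) (w j)) = sum X (B b - S b)"
      using Bdiv by (intro sum.cong) (auto simp: w_def X_def)
    also have "sum X (B b - S b) = sum X (B b) - sum X (S b)"
      using S(1) by (intro sum_diff) (auto simp: B_def)
    finally have w: "(\<Sum>j\<in>B b. shadow_est d (projector \<psi>) (w j))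
        = sum X (B b) - sum X (S b) + real m * real d"
      by (simp add: S(2))
    have "sum X (S b) \<le> real m / real K * sum X (B b)"
      using S(3)[of b] K by (simp add: field_simps)
    then have "(1 - real m / real K) * sum X (B b) + real m * real d
        \<le> (\<Sum>j\<in>B b. shadow_est d (projector \<psi>) (w j))"
      unfolding w by (simp add: algebra_simps)
    then have "((1 - real m / real K) * sum X (B b) + real m * real d) / real K
        \<le> (\<Sum>j\<in>B b. shadow_est d (projector \<psi>) (w j)) / real K"
      by (rule divide_right_mono) simp
    then show ?thesis
      unfolding batch_mean_def by (simp add: B_def X_def add_divide_distrib)
  qed
  let ?h = "\<lambda>x. (1 - real m / real K) * x + real m / real K * real d"
  have "?h (mom_estimate d (projector \<psi>) K (N * K) v)
      = median (map ?h (map (batch_mean d (projector \<psi>) K v) [0..<N]))"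
    unfolding mom_estimate_def using K N m by (subst median_affine) auto
  also have "\<dots> \<le> mom_estimate d (projector \<psi>) K (N * K) w"
    unfolding mom_estimate_def using K N batch by (intro median_mono) auto
  finally show ?thesis
    using card v \<psi> by (intro exI[of _ w]) (auto simp: w_def)
qed

section \<open>Choice of the corruption level and the constants\<close>

lemma mom_adversary:
  assumes K: "K \<ge> 1" and N: "N > 0" and d: "d \<ge> 2"
    and \<gamma>: "1 / real K \<le> \<gamma>" "\<gamma> \<le> 1" and \<psi>: "\<psi> \<in> unit_sphere_c d"
    and v: "\<And>j. j < N * K \<Longrightarrow> v j \<in> unit_sphere_c d"
  shows "\<exists>w. (\<forall>j < N * K. w j \<in> unit_sphere_c d) \<and>
    real (card {j. j < N * K \<and> w j \<noteq> v j}) \<le> 2 * \<gamma> * real (N * K) \<and>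
    \<bar>mom_estimate d (projector \<psi>) K (N * K) w - 1 / real d\<bar> \<ge> 1 / 4 * \<gamma> * real d"
\<comment> \<open>A median far below \<open>1 / d\<close> could be pushed towards the target by the
  corruption, so a sample with a large error is left untouched.\<close>
proof (cases "\<bar>mom_estimate d (projector \<psi>) K (N * K) v - 1 / real d\<bar> \<ge> 1 / 4 * \<gamma> * real d")
  case True
  have "\<gamma> \<ge> 0" using \<gamma>(1) by (rule order_trans[rotated]) simp
  then show ?thesis using True v by (intro exI[of _ v]) auto
next
  case False
  \<comment> \<open>Rounding up makes the corrupted fraction \<open>g\<close> at least
    \<gamma>.\<close>
  define m where "m = nat \<lceil>\<gamma> * real K\<rceil>"
  define g where "g = real m / real K"
  have \<gamma>K: "1 \<le> \<gamma> * real K" using \<gamma>(1) K by (simp add: field_simps)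
  have "real m = of_int \<lceil>\<gamma> * real K\<rceil>" using \<gamma>K by (simp add: m_def)
  \<comment> \<open>From \<gamma> \<ge> \<open>1 / K\<close>, the rounding error is below 1 \<le>
    \<gamma>\<open>K\<close>; this gives the factor 2 in the corruption budget.\<close>
  then have m: "\<gamma> * real K \<le> real m" "real m \<le> 2 * (\<gamma> * real K)"
    using \<gamma>K ceiling_correct[of "\<gamma> * real K"] by linarith+
  have "\<gamma> * real K \<le> real K" using mult_right_mono[OF \<gamma>(2), of "real K"] by simp
  then have mK: "m \<le> K" by (simp add: m_def nat_le_iff ceiling_le_iff)
  have g: "\<gamma> \<le> g" "g \<le> 1" using m(1) mK K by (auto simp: g_def field_simps)
  have "\<gamma> > 0" using \<gamma>K by (cases "\<gamma> > 0") (auto simp: not_less dest: mult_nonpos_nonneg[of \<gamma> "real K"])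
  then have "g > 0" using g by simp
  obtain w where w: "\<forall>j < N * K. w j \<in> unit_sphere_c d"
      "card {j. j < N * K \<and> w j \<noteq> v j} \<le> N * m"
      "mom_estimate d (projector \<psi>) K (N * K) w
        \<ge> (1 - g) * mom_estimate d (projector \<psi>) K (N * K) v + g * real d"
    using mom_corruption[OF K mK N \<psi>, of v] v unfolding g_def by blast
  have "real (card {j. j < N * K \<and> w j \<noteq> v j}) \<le> real N * real m"
    using w(2) by (metis of_nat_le_iff of_nat_mult)
  also have "\<dots> \<le> real N * (2 * (\<gamma> * real K))" using m(2) by (rule mult_left_mono) simp
  finally have card: "real (card {j. j < N * K \<and> w j \<noteq> v j}) \<le> 2 * \<gamma> * real (N * K)"
    by (simp add: mult_ac)
  define x where "x = mom_estimate d (projector \<psi>) K (N * K) v"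
  have gd: "\<gamma> * real d \<le> g * real d" using g(1) by (rule mult_right_mono) simp
  have "x \<ge> 1 / real d - 1 / 4 * (g * real d)"
    using False gd unfolding x_def by linarith
  then have x1: "(1 - g) * x \<ge> (1 - g) * (1 / real d - 1 / 4 * (g * real d))"
    using g(2) by (intro mult_left_mono) auto
  have x2: "(1 - g) * (1 / real d - 1 / 4 * (g * real d))
      = 1 / real d - g * (1 / real d) - 1 / 4 * (g * real d) + 1 / 4 * (g * (g * real d))"
    by (simp add: algebra_simps diff_divide_distrib)
  have "g * (g * real d) \<ge> 0" using \<open>g > 0\<close> by simp
  then have x: "(1 - g) * x \<ge> 1 / real d - g * (1 / real d) - 1 / 4 * (g * real d)"
    using x1 unfolding x2 by linarith
  \<comment> \<open>Of the gain \<open>g * d\<close>, at most \<open>g * d / 4\<close> is lost to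
    the initial offset and at most \<open>g * d / 2\<close> to shrinking the target
    \<open>1 / d\<close> by \<open>1 - g\<close>. The remaining quarter is the claimed
    error.\<close>
  have "1 / real d \<le> 1" "1 \<le> 1 / 2 * real d" using d by simp_all
  then have "1 / real d \<le> 1 / 2 * real d" by (rule order_trans)
  then have "g * (1 / real d) \<le> g * (1 / 2 * real d)"
    using \<open>g > 0\<close> by (intro mult_left_mono) auto
  then have "mom_estimate d (projector \<psi>) K (N * K) w - 1 / real d \<ge> 1 / 4 * (g * real d)"
    using w(3) x unfolding x_def by linarith
  then have "\<bar>mom_estimate d (projector \<psi>) K (N * K) w - 1 / real d\<bar> \<ge> 1 / 4 * \<gamma> * real d"
    using gd by linarith
  then show ?thesis using w(1) card by blast
qed

text \<open>The sample size is \<open>n = N * K\<close>, and the limit in \<open>N\<close> expresses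
  that \<open>n\<close> is large. The corrupted \<open>w\<close> is chosen after \<open>v\<close> is
  seen, so the events \<open>E N\<close> are those on which an adaptive adversary succeeds.\<close>

theorem theorem4:
  "\<exists>c > 0. \<exists>C > 0. \<forall>d K \<gamma> \<psi>.
     d \<ge> 1000 \<and> K \<ge> 1 \<and> 1 / real K \<le> \<gamma> \<and> \<gamma> \<le> 1 \<and> \<psi> \<in> unit_sphere_c d \<longrightarrow>
     (\<exists>E :: nat \<Rightarrow> (nat \<Rightarrow> cvec) set.
        (\<forall>N. E N \<in> sets (povm_samples d (maximally_mixed d) (N * K))) \<and>
        (\<lambda>N. measure (povm_samples d (maximally_mixed d) (N * K)) (E N)) \<longlonglongrightarrow> 1 \<and>
        (\<forall>N. \<forall>v \<in> E N. \<exists>w :: nat \<Rightarrow> cvec.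
            (\<forall>j < N * K. w j \<in> unit_sphere_c d) \<and>
            real (card {j. j < N * K \<and> w j \<noteq> v j}) \<le> C * \<gamma> * real (N * K) \<and>
            \<bar>mom_estimate d (projector \<psi>) K (N * K) w
               - Re (mtrace d (mmult d (projector \<psi>) (maximally_mixed d)))\<bar>
              \<ge> c * \<gamma> * real d))"
proof -
  have main: "\<exists>E :: nat \<Rightarrow> (nat \<Rightarrow> cvec) set.
        (\<forall>N. E N \<in> sets (povm_samples d (maximally_mixed d) (N * K))) \<and>
        (\<lambda>N. measure (povm_samples d (maximally_mixed d) (N * K)) (E N)) \<longlonglongrightarrow> 1 \<and>
        (\<forall>N. \<forall>v \<in> E N. \<exists>w :: nat \<Rightarrow> cvec.
            (\<forall>j < N * K. w j \<in> unit_sphere_c d) \<and>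
            real (card {j. j < N * K \<and> w j \<noteq> v j}) \<le> 2 * \<gamma> * real (N * K) \<and>
            \<bar>mom_estimate d (projector \<psi>) K (N * K) w
               - Re (mtrace d (mmult d (projector \<psi>) (maximally_mixed d)))\<bar>
              \<ge> 1 / 4 * \<gamma> * real d)"
    if d: "d \<ge> 1000" and K: "K \<ge> 1" and \<gamma>: "1 / real K \<le> \<gamma>" "\<gamma> \<le> 1"
      and \<psi>: "\<psi> \<in> unit_sphere_c d" for d K \<gamma> \<psi>
  proof -
    let ?P = "\<lambda>N. povm_samples d (maximally_mixed d) (N * K)"
    \<comment> \<open>For \<open>N = 0\<close> the estimate is the median of the empty list, a junk value.\<close>
    define E where "E = (\<lambda>N. if N = 0 then {} else space (?P N))"
    have P: "?P N = PiM {..<N * K} (\<lambda>_. uniform_sphere d)" for N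
      using d by (simp add: povm_samples_def povm_outcome_maximally_mixed)
    have "prob_space (?P N)" for N
      unfolding P using d by (intro prob_space_PiM prob_space_uniform_sphere) simp
    \<comment> \<open>\<open>E N\<close> is the whole sample space for \<open>N > 0\<close>, so the
      limit is that of an eventually constant sequence.\<close>
    then have "measure (?P N) (E N) = 1" if "N > 0" for N
      using that by (simp add: E_def prob_space.prob_space)
    then have "\<forall>\<^sub>F N in sequentially. measure (?P N) (E N) = 1"
      by (intro eventually_sequentiallyI[of 1]) simp
    then have lim: "(\<lambda>N. measure (?P N) (E N)) \<longlonglongrightarrow> 1"
      by (rule tendsto_eventually)
    have tr: "Re (mtrace d (mmult d (projector \<psi>) (maximally_mixed d))) = 1 / real d"
      by (simp add: mtrace_projector_maximally_mixed[OF \<psi>])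
    show ?thesis
    proof (intro exI[of _ E] conjI allI ballI)
      show "E N \<in> sets (?P N)" for N by (simp add: E_def)
      show "(\<lambda>N. measure (?P N) (E N)) \<longlonglongrightarrow> 1" by (rule lim)
      fix N v assume v: "v \<in> E N"
      then have N: "N > 0" by (auto simp: E_def split: if_splits)
      have "v \<in> space (PiM {..<N * K} (\<lambda>_. uniform_sphere d))"
        using v N unfolding P[symmetric] by (simp add: E_def)
      then have "v j \<in> unit_sphere_c d" if "j < N * K" for j
        using that by (auto simp: space_PiM space_uniform_sphere)
      then show "\<exists>w :: nat \<Rightarrow> cvec. (\<forall>j < N * K. w j \<in> unit_sphere_c d) \<and>
            real (card {j. j < N * K \<and> w j \<noteq> v j}) \<le> 2 * \<gamma> * real (N * K) \<and>
            \<bar>mom_estimate d (projector \<psi>) K (N * K) w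
               - Re (mtrace d (mmult d (projector \<psi>) (maximally_mixed d)))\<bar>
              \<ge> 1 / 4 * \<gamma> * real d"
        unfolding tr using d by (intro mom_adversary[OF K N _ \<gamma> \<psi>]) auto
    qed
  qed
  show ?thesis
    by (rule exI[of _ "1/4"], rule conjI, simp, rule exI[of _ 2], rule conjI, simp)
       (use main in blast)
qed

end
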